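(* Let $n\ge 1$ be an integer and $\sigma>0$. The GOE density $p_{GOE,n,\sigma^2}$ satisfies, for all $x\in\mathbb{R}$, the differential equation $$4\sigma^4 p_{GOE,n,\sigma^2}'''(x) + \bigl(\sigma^2(4n-2)- x^2\bigr)p_{GOE,n,\sigma^2}'(x) - 2x\, p_{GOE,n,\sigma^2}(x) = -3\sigma^2 p_{GUE,n,\sigma^2}'(x)-3x\, p_{GUE,n,\sigma^2}(x).$$
   Context: The Hermite polynomials are $H_k(x)=(-1)^k e^{x^2}\frac{d^k}{dx^k}e^{-x^2}$ and the Hermite functions are $\phi_k(x)=\frac{1}{\sqrt{2^k k!\sqrt{\pi}}}H_k(x)e^{-x^2/2}$, $k\ge 0$. For an integer $n\ge 1$ and $\sigma>0$ define $$p_{GUE,n,\sigma^2}(x)=\frac{1}{\sigma\sqrt2}\sum_{k=0}^{n-1}\phi_k\Bigl(\frac{x}{\sigma\sqrt2}\Bigr)^2,\qquad \tau_n(x)=\sqrt{\frac n2}\,\phi_{n-1}(x)\,\frac12\int_{\mathbb{R}}\operatorname{sign}(x-t)\phi_n(t)\,dt,$$ $$\alpha_n(x)=\phi_{n-1}(x)\Bigl(\int_{\mathbb{R}}\phi_{n-1}(t)\,dt\Bigr)^{-1}\text{ if } n \text{ is odd},\qquad \alpha_n(x)=0\text{ if } n\text{ is even},$$ $$p_{GOE,n,\sigma^2}(x)=p_{GUE,n,\sigma^2}(x)+\frac{1}{\sigma\sqrt2}\Bigl(\tau_n\Bigl(\frac{x}{\sigma\sqrt2}\Bigr)+\alpha_n\Bigl(\frac{x}{\sigma\sqrt2}\Bigr)\Bigr).$$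 These are the (unnormalized) mean eigenvalue densities of the Gaussian Unitary and Gaussian Orthogonal Ensembles. *)

theory Defs
  imports "HOL-Analysis.Analysis"
begin

definition hermite_poly :: "nat \<Rightarrow> real \<Rightarrow> real" where
  "hermite_poly k x = (-1) ^ k * exp (x\<^sup>2) * (deriv ^^ k) (\<lambda>t. exp (- t\<^sup>2)) x"

definition hermite_fun :: "nat \<Rightarrow> real \<Rightarrow> real" where
  "hermite_fun k x = 1 / sqrt (2 ^ k * fact k * sqrt pi) * hermite_poly k x * exp (- x\<^sup>2 / 2)"

text \<open>In the densities, the parameter \<open>\<sigma>\<close> is the standard deviation, not the variance
  \<open>\<sigma>\<^sup>2\<close>. The index \<open>n - 1\<close> below is truncated at \<open>n = 0\<close>; the definitions are meant
  for \<open>n \<ge> 1\<close>.\<close>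

definition p_GUE :: "nat \<Rightarrow> real \<Rightarrow> real \<Rightarrow> real" where
  "p_GUE n \<sigma> x = 1 / (\<sigma> * sqrt 2) * (\<Sum>k<n. (hermite_fun k (x / (\<sigma> * sqrt 2)))\<^sup>2)"

definition tau :: "nat \<Rightarrow> real \<Rightarrow> real" where
  "tau n x = sqrt (real n / 2) * hermite_fun (n - 1) x *
     (1 / 2 * (\<integral>t. sgn (x - t) * hermite_fun n t \<partial>lborel))"

definition alpha :: "nat \<Rightarrow> real \<Rightarrow> real" where
  "alpha n x =
     (if odd n then hermite_fun (n - 1) x * inverse (\<integral>t. hermite_fun (n - 1) t \<partial>lborel) else 0)"

definition p_GOE :: "nat \<Rightarrow> real \<Rightarrow> real \<Rightarrow> real" where
  "p_GOE n \<sigma> x = p_GUE n \<sigma> x +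
     1 / (\<sigma> * sqrt 2) * (tau n (x / (\<sigma> * sqrt 2)) + alpha n (x / (\<sigma> * sqrt 2)))"

end

theory Submission
  imports Defs "HOL-Probability.Distributions" "HOL-Computational_Algebra.Polynomial"
begin

text \<open>
  Put \<open>s = sqrt (2 * n)\<close>, \<open>\<phi> = \<phi>\<^bsub>n-1\<^esub>\<close> and \<open>\<psi> = \<phi>\<^bsub>n\<^esub>\<close>. The ladder relations
  \<open>\<phi>' = x \<phi> - s \<psi>\<close> and \<open>\<psi>' = - x \<psi> + s \<phi>\<close> form a closed system. By the confluent
  Christoffel-Darboux formula the GUE density is a quadratic form in \<open>\<phi>\<close>, \<open>\<psi>\<close>, and
  \<open>\<tau>\<^sub>n + \<alpha>\<^sub>n = \<phi> F\<close> with \<open>F' = (s / 2) \<psi>\<close>, whatever the additive constant in \<open>F\<close>. After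
  rescaling to \<open>\<sigma> sqrt 2 = 1\<close>, the left-hand side of the equation is the derivative of
  \<open>u'' + (2 n - 1 - x\<^sup>2) u\<close>, an operator that annihilates \<open>\<phi>\<close>; hence \<open>F\<close> drops out and
  what remains is a polynomial identity in \<open>x\<close>, \<open>s\<close>, \<open>\<phi>\<close>, \<open>\<psi>\<close>.
\<close>

text \<open>Differentiating \<open>p * exp (- x^2)\<close> replaces \<open>p\<close> by
  \<open>p' - 2 x p\<close>; the recursion is this rule with the sign \<open>(-1) ^ k\<close>
  absorbed.\<close>

primrec hermite_pol :: "nat \<Rightarrow> real poly" where
  "hermite_pol 0 = 1"
| "hermite_pol (Suc k) = [:0, 2:] * hermite_pol k - pderiv (hermite_pol k)"

text \<open>Differentiate the recursion. By the induction hypothesis both derivatives on the right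
  come from \<open>hermite_pol k\<close>, and the recursion itself reassembles them.\<close>

lemma pderiv_hermite_pol:
  "pderiv (hermite_pol (Suc k)) = smult (2 * real (Suc k)) (hermite_pol k)"
proof (induction k)
  case 0
  show ?case by (simp add: pderiv_pCons pderiv_1)
next
  case (Suc k)
  have "pderiv (hermite_pol (Suc (Suc k))) =
      smult 2 (hermite_pol (Suc k)) + [:0, 2:] * pderiv (hermite_pol (Suc k))
        - pderiv (pderiv (hermite_pol (Suc k)))"
    by (simp only: hermite_pol.simps(2)[of "Suc k"] pderiv_diff pderiv_mult)
       (simp add: pderiv_pCons)
  also have "\<dots> = smult 2 (hermite_pol (Suc k)) + smult (2 * real (Suc k)) (hermite_pol (Suc k))"
    unfolding Suc.IH by (simp add: pderiv_smult smult_diff_right)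
  also have "\<dots> = smult (2 * real (Suc (Suc k))) (hermite_pol (Suc k))"
    by (simp add: smult_add_left[symmetric] del: hermite_pol.simps)
  finally show ?case .
qed

lemma higher_deriv_gaussian:
  "(deriv ^^ k) (\<lambda>t::real. exp (- t\<^sup>2)) = (\<lambda>x. (-1) ^ k * poly (hermite_pol k) x * exp (- x\<^sup>2))"
proof (induction k)
  case 0
  show ?case by simp
next
  case (Suc k)
  have "((\<lambda>x. (-1) ^ k * poly (hermite_pol k) x * exp (- x\<^sup>2)) has_real_derivative
      (-1) ^ Suc k * poly (hermite_pol (Suc k)) x * exp (- x\<^sup>2)) (at x)" for x :: real
    by (auto intro!: derivative_eq_intros simp: algebra_simps)
  then show ?case
    by (auto simp: Suc.IH intro!: DERIV_imp_deriv)
qed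

lemma hermite_poly_eq_poly: "hermite_poly k x = poly (hermite_pol k) x"
proof -
  have "hermite_poly k x =
      ((-1) ^ k * (-1) ^ k) * (exp (x\<^sup>2) * exp (- x\<^sup>2)) * poly (hermite_pol k) x"
    unfolding hermite_poly_def higher_deriv_gaussian by (simp only: mult_ac)
  then show ?thesis
    by (simp add: exp_minus flip: power_mult_distrib)
qed

lemma hermite_fun_eq:
  "hermite_fun k x = 1 / sqrt (2 ^ k * fact k * sqrt pi) * poly (hermite_pol k) x * exp (- x\<^sup>2 / 2)"
  by (simp add: hermite_fun_def hermite_poly_eq_poly)

text \<open>Lets two consecutive Hermite functions share one normalizing constant, with ratio
  \<open>s\<close>.\<close>

lemma hermite_fun_norm_Suc:
  "1 / sqrt (2 ^ k * fact k * sqrt pi) =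
    sqrt (2 * real (Suc k)) / sqrt (2 ^ Suc k * fact (Suc k) * sqrt pi)"
proof -
  have "sqrt (2 ^ Suc k * fact (Suc k) * sqrt pi) =
      sqrt (2 * real (Suc k)) * sqrt (2 ^ k * fact k * sqrt pi)"
    by (simp flip: real_sqrt_mult add: algebra_simps)
  then show ?thesis by simp
qed

lemma hermite_fun_has_derivative_lower:
  "(hermite_fun (Suc k) has_real_derivative
     - x * hermite_fun (Suc k) x + sqrt (2 * real (Suc k)) * hermite_fun k x) (at x)"
proof -
  define N where "N = 1 / sqrt (2 ^ Suc k * fact (Suc k) * sqrt pi)"
  define s where "s = sqrt (2 * real (Suc k))"
  have s: "s * s = 2 * real (Suc k)" by (simp add: s_def)
  have *: "hermite_fun (Suc k) = (\<lambda>x. N * poly (hermite_pol (Suc k)) x * exp (- x\<^sup>2 / 2))"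
    by (simp add: fun_eq_iff hermite_fun_eq N_def)
  have **: "hermite_fun k x = s * N * poly (hermite_pol k) x * exp (- x\<^sup>2 / 2)"
    unfolding hermite_fun_eq hermite_fun_norm_Suc[of k] N_def s_def by simp
  have d: "poly (pderiv (hermite_pol (Suc k))) x = s * s * poly (hermite_pol k) x"
    unfolding pderiv_hermite_pol s by simp
  show ?thesis
    unfolding * ** s_def[symmetric]
    by (rule derivative_eq_intros refl | simp del: hermite_pol.simps)+
       (simp only: d, simp add: algebra_simps)
qed

text \<open>With \<open>H\<close> for \<open>hermite_pol k\<close>, the recursion turns
  \<open>H' - x H\<close> into \<open>x H - hermite_pol (Suc k)\<close>.\<close>

lemma hermite_fun_has_derivative_raise:
  "(hermite_fun k has_real_derivative
     x * hermite_fun k x - sqrt (2 * real (Suc k)) * hermite_fun (Suc k) x) (at x)"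
proof -
  define N where "N = 1 / sqrt (2 ^ Suc k * fact (Suc k) * sqrt pi)"
  define s where "s = sqrt (2 * real (Suc k))"
  have *: "hermite_fun k = (\<lambda>x. s * N * poly (hermite_pol k) x * exp (- x\<^sup>2 / 2))"
    unfolding fun_eq_iff hermite_fun_eq hermite_fun_norm_Suc[of k] N_def s_def by simp
  have **: "hermite_fun (Suc k) x = N * poly (hermite_pol (Suc k)) x * exp (- x\<^sup>2 / 2)"
    by (simp add: hermite_fun_eq N_def)
  show ?thesis
    unfolding * ** s_def[symmetric]
    by (auto intro!: derivative_eq_intros simp: algebra_simps)
qed

lemma hermite_fun_three_term:
  "sqrt (2 * real (Suc (Suc k))) * hermite_fun (Suc (Suc k)) x =
    2 * x * hermite_fun (Suc k) x - sqrt (2 * real (Suc k)) * hermite_fun k x"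
  using DERIV_unique[OF hermite_fun_has_derivative_lower[of k x]
      hermite_fun_has_derivative_raise[of "Suc k" x]]
  by simp

text \<open>This is the confluent kernel with derivatives eliminated by the ladder relations. The
  induction step needs only the three-term recurrence and the growth of \<open>s^2\<close> by
  2.\<close>

lemma christoffel_darboux:
  fixes x :: real
  defines "s \<equiv> \<lambda>m. sqrt (2 * real (Suc m))"
  shows "(\<Sum>k<Suc m. (hermite_fun k x)\<^sup>2) =
    (s m)\<^sup>2 / 2 * ((hermite_fun m x)\<^sup>2 + (hermite_fun (Suc m) x)\<^sup>2)
      - s m * x * hermite_fun m x * hermite_fun (Suc m) x"
proof (induction m)
  case 0
  \<comment> \<open>The recurrence one index below \<open>hermite_fun_three_term\<close>, where no
    lower function occurs.\<close>
  have "sqrt 2 * hermite_fun 1 x = 2 * x * hermite_fun 0 x"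
    unfolding hermite_fun_eq by (simp add: real_sqrt_mult)
  then have "(sqrt 2)\<^sup>2 / 2 * ((hermite_fun 0 x)\<^sup>2 + (hermite_fun 1 x)\<^sup>2)
      - sqrt 2 * x * hermite_fun 0 x * hermite_fun 1 x = (sqrt 2)\<^sup>2 / 2 * (hermite_fun 0 x)\<^sup>2"
    by algebra
  then show ?case by (simp add: s_def)
next
  case (Suc m)
  have r: "s (Suc m) * hermite_fun (Suc (Suc m)) x = 2 * x * hermite_fun (Suc m) x - s m * hermite_fun m x"
    unfolding s_def by (rule hermite_fun_three_term)
  have s: "(s (Suc m))\<^sup>2 = (s m)\<^sup>2 + 2"
    by (simp add: s_def)
  show ?case
    unfolding sum.lessThan_Suc[of _ "Suc m"] Suc.IH using r s by algebra
qed

text \<open>Up to a constant, \<open>exp (- x^2 / 2)\<close> is the standard normal density, all of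
  whose moments exist.\<close>

lemma integrable_hermite_fun: "integrable lborel (hermite_fun k)"
proof -
  have eq: "hermite_fun k = (\<lambda>x. \<Sum>i\<le>degree (hermite_pol k).
      1 / sqrt (2 ^ k * fact k * sqrt pi) * sqrt (2 * pi) * coeff (hermite_pol k) i *
        (std_normal_density x * x ^ i))"
    by (simp add: fun_eq_iff hermite_fun_eq poly_altdef sum_distrib_left sum_distrib_right sum_divide_distrib
        std_normal_density_def algebra_simps)
  show ?thesis
    unfolding eq
    by (intro Bochner_Integration.integrable_sum integrable_mult_right
        integrable_std_normal_moment)
qed

text \<open>Moving \<open>x\<close> to the right transfers mass of \<open>f\<close> from weight -1
  to weight +1, so the fundamental theorem of calculus gives the factor 2.\<close>

lemma has_derivative_integral_sgn:
  fixes f :: "real \<Rightarrow> real"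
  assumes int: "integrable lborel f" and cont: "continuous_on UNIV f"
  shows "((\<lambda>x. \<integral>t. sgn (x - t) * f t \<partial>lborel) has_real_derivative 2 * f x) (at x)"
proof -
  let ?E = "\<lambda>x. \<integral>t. sgn (x - t) * f t \<partial>lborel"
  have sgn_int: "integrable lborel (\<lambda>t. sgn (y - t) * f t)" for y
    by (rule Bochner_Integration.integrable_bound[OF int])
       (use int in \<open>auto simp: abs_mult sgn_if\<close>)
  \<comment> \<open>A base point strictly left of \<open>x\<close> makes \<open>x\<close> interior
    to the interval, so the derivative is two-sided; the formula \<open>E\<close> then covers all
    points within distance 1.\<close>
  define a where "a = x - 1"
  have E: "?E y = ?E a + 2 * integral {a..y} f" if "a \<le> y" for y
  proof -
    have "?E y - ?E a = (\<integral>t. sgn (y - t) * f t - sgn (a - t) * f t \<partial>lborel)"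
      using sgn_int by simp
    also have "\<dots> = (\<integral>t. 2 * (indicator {a..y} t *\<^sub>R f t) \<partial>lborel)"
    proof (rule integral_cong_AE)
      \<comment> \<open>If \<open>a < y\<close>, the sign difference is 1 rather than 2 at the
        endpoints, hence only almost everywhere.\<close>
      show "AE t in lborel. sgn (y - t) * f t - sgn (a - t) * f t = 2 * (indicator {a..y} t *\<^sub>R f t)"
        using AE_lborel_singleton[of a] AE_lborel_singleton[of y]
        by eventually_elim (use that in \<open>auto simp: sgn_if indicator_def\<close>)
    qed (use int in auto)
    also have "\<dots> = 2 * (LBINT t:{a..y}. f t)"
      by (simp add: set_lebesgue_integral_def)
    also have "(LBINT t:{a..y}. f t) = integral {a..y} f"
      using int
      by (intro set_borel_integral_eq_integral)
         (simp add: set_integrable_def integrable_mult_indicator del: real_scaleR_def)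
    finally show ?thesis by simp
  qed
  have "((\<lambda>y. integral {a..y} f) has_real_derivative f x) (at x within {a..x + 1})"
    by (rule integral_has_real_derivative)
       (auto simp: a_def intro: continuous_on_subset[OF cont])
  then have "((\<lambda>y. integral {a..y} f) has_real_derivative f x) (at x)"
    by (simp add: a_def at_within_Icc_at)
  then have "((\<lambda>y. ?E a + 2 * integral {a..y} f) has_real_derivative 2 * f x) (at x)"
    by (auto intro!: derivative_eq_intros)
  then show ?thesis
    by (rule has_field_derivative_transform_within[where d = 1])
       (auto intro!: E[symmetric] simp: dist_real_def, simp add: a_def)
qed

lemma higher_deriv_eqI:
  fixes u :: "nat \<Rightarrow> real \<Rightarrow> real"
  assumes "\<And>j x. j < n \<Longrightarrow> (u j has_real_derivative u (Suc j) x) (at x)"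
  shows "j \<le> n \<Longrightarrow> (deriv ^^ j) (u 0) = u j"
proof (induction j)
  case (Suc j)
  then have "(deriv ^^ Suc j) (u 0) = deriv (u j)" by simp
  also have "\<dots> = u (Suc j)"
    using Suc.prems by (intro ext DERIV_imp_deriv assms) simp
  finally show ?case .
qed simp

theorem proposition1p4:
  fixes n :: nat and \<sigma> :: real
  assumes "n \<ge> 1" and "\<sigma> > 0"
  shows "\<forall>x::real.
    p_GUE n \<sigma> differentiable (at x) \<and>
    (\<forall>j<3. (deriv ^^ j) (p_GOE n \<sigma>) differentiable (at x)) \<and>
    4 * \<sigma> ^ 4 * (deriv ^^ 3) (p_GOE n \<sigma>) x
      + (\<sigma>\<^sup>2 * (4 * real n - 2) - x\<^sup>2) * deriv (p_GOE n \<sigma>) x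
      - 2 * x * p_GOE n \<sigma> x
    = - 3 * \<sigma>\<^sup>2 * deriv (p_GUE n \<sigma>) x - 3 * x * p_GUE n \<sigma> x"
proof -
  obtain m where n: "n = Suc m" using assms(1) by (cases n) auto
  define s where "s = sqrt (2 * real (Suc m))"
  define c where "c = 1 / (\<sigma> * sqrt 2)"
  define f where "f = hermite_fun m"
  define g where "g = hermite_fun (Suc m)"
  \<comment> \<open>Here \<open>s / 4\<close> is \<open>sqrt (n / 2)\<close> times the factor 1/2 in
    \<open>tau\<close>. The \<open>alpha\<close> term only adds a constant, since
    \<open>alpha\<close> is a multiple of \<open>f\<close>.\<close>
  define F where "F y = s / 4 * (\<integral>t. sgn (y - t) * g t \<partial>lborel)
    + (if odd n then inverse (\<integral>t. f t \<partial>lborel) else 0)" for y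
  have s2: "s\<^sup>2 = 2 * real n" by (simp add: s_def n)
  have c2: "2 * (\<sigma>\<^sup>2 * c\<^sup>2) = 1"
    using assms(2) by (simp add: c_def power_divide power_mult_distrib)
  have df: "(f has_real_derivative y * f y - s * g y) (at y)" for y
    unfolding f_def g_def s_def by (rule hermite_fun_has_derivative_raise)
  have dg: "(g has_real_derivative - y * g y + s * f y) (at y)" for y
    unfolding f_def g_def s_def by (rule hermite_fun_has_derivative_lower)
  have cont: "continuous_on UNIV g"
    by (intro continuous_at_imp_continuous_on ballI) (rule DERIV_isCont[OF dg])
  have dF: "(F has_real_derivative s / 2 * g y) (at y)" for y
  proof -
    have "integrable lborel g" unfolding g_def by (rule integrable_hermite_fun)
    from has_derivative_integral_sgn[OF this cont, of y]
    have "((\<lambda>y. s / 4 * (\<integral>t. sgn (y - t) * g t \<partial>lborel) +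
        (if odd n then inverse (\<integral>t. f t \<partial>lborel) else 0)) has_real_derivative s / 4 * (2 * g y) + 0) (at y)"
      by (intro DERIV_add DERIV_cmult DERIV_const)
    then show ?thesis by (simp add: F_def[abs_def])
  qed
  note D = df dg dF df[THEN DERIV_chain2] dg[THEN DERIV_chain2] dF[THEN DERIV_chain2]

  define v where "v y = s\<^sup>2 / 2 * ((f y)\<^sup>2 + (g y)\<^sup>2) - s * y * f y * g y" for y
  \<comment> \<open>Entry \<open>j\<close> is the \<open>j\<close>-th derivative of
    \<open>v + f F\<close>, with \<open>f'\<close>, \<open>g'\<close>, \<open>F'\<close> eliminated;
    from entry 2 on, \<open>f'' = (y^2 - s^2 + 1) f\<close> is used.\<close>
  define u where "u j y =
    [v y + f y * F y,
     (y * f y - s * g y) * F y - s / 2 * f y * g y,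
     (y\<^sup>2 - s\<^sup>2 + 1) * f y * F y + s / 2 * y * f y * g y - s\<^sup>2 / 2 * (f y)\<^sup>2,
     2 * y * f y * F y + (y\<^sup>2 - s\<^sup>2 + 1) * ((y * f y - s * g y) * F y + s / 2 * f y * g y)
       + s / 2 * f y * g y + s\<^sup>2 / 2 * y * ((f y)\<^sup>2 - (g y)\<^sup>2)
       - s\<^sup>2 * f y * (y * f y - s * g y)] ! j" for j :: nat and y
  have dv: "(v has_real_derivative - s * f y * g y) (at y)" for y
    unfolding v_def
    by (rule derivative_eq_intros D refl)+ (simp add: field_simps power2_eq_square)
  have du: "(u j has_real_derivative u (Suc j) y) (at y)" if j: "j < 3" for j y
  proof -
    consider "j = 0" | "j = 1" | "j = 2" using j by linarith
    then show ?thesis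
    proof cases
      case 1
      show ?thesis unfolding 1 u_def
        by simp (auto intro!: derivative_eq_intros dv D simp: field_simps power2_eq_square)
    next
      case 2
      show ?thesis unfolding 2 u_def
        by simp (auto intro!: derivative_eq_intros dv D simp: field_simps power2_eq_square)
    next
      case 3
      show ?thesis unfolding 3 u_def
        by (simp add: numeral_2_eq_2)
           (auto intro!: derivative_eq_intros dv D simp: field_simps power2_eq_square)
    qed
  qed
  \<comment> \<open>The claim at \<open>\<sigma>^2 = 1/2\<close>: the terms containing
    \<open>F\<close> cancel, and \<open>s * f y * g y\<close> on the right is
    \<open>- v'\<close>.\<close>
  have ode: "u 3 y + (s\<^sup>2 - 1 - y\<^sup>2) * u 1 y - 2 * y * u 0 y = 3 / 2 * (s * f y * g y) - 3 * y * v y" for y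
    by (simp add: u_def v_def numeral_3_eq_3 field_simps power2_eq_square)

  have GUE: "p_GUE n \<sigma> = (\<lambda>x. c * v (c * x))"
    unfolding p_GUE_def n christoffel_darboux by (simp add: fun_eq_iff c_def v_def f_def g_def s_def)
  have half: "sqrt (real n / 2) = s / 2"
    by (rule real_sqrt_unique) (auto simp: s2[unfolded s_def] n s_def power_divide)
  have "tau n y + alpha n y = f y * F y" for y
    unfolding tau_def alpha_def half F_def by (simp add: n f_def g_def algebra_simps)
  then have GOE: "p_GOE n \<sigma> = (\<lambda>x. c * u 0 (c * x))"
    unfolding p_GOE_def GUE by (simp add: fun_eq_iff u_def c_def algebra_simps)

  \<comment> \<open>One factor \<open>c\<close> is the prefactor of the density; each derivative
    contributes another.\<close>
  define U where "U j x = c ^ Suc j * u j (c * x)" for j x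
  have dU: "(U j has_real_derivative U (Suc j) x) (at x)" if "j < 3" for j x
    unfolding U_def by (auto intro!: derivative_eq_intros du[THEN DERIV_chain2] that)
  have DU: "(deriv ^^ j) (p_GOE n \<sigma>) = U j" if "j \<le> 3" for j
    using higher_deriv_eqI[of 3 U j] dU that by (simp add: GOE U_def[abs_def])
  have dGUE: "(p_GUE n \<sigma> has_real_derivative c\<^sup>2 * (- s * f (c * x) * g (c * x))) (at x)" for x
    unfolding GUE by (auto intro!: derivative_eq_intros dv[THEN DERIV_chain2] simp: power2_eq_square)

  show ?thesis
  proof (intro allI conjI impI)
    fix x :: real
    \<comment> \<open>As \<open>deriv\<close> is total, the differentiability claims certify that
      each \<open>deriv\<close> in the equation is a genuine derivative.\<close>
    show "p_GUE n \<sigma> differentiable (at x)"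
      using dGUE by (auto simp: real_differentiable_def)
    show "(deriv ^^ j) (p_GOE n \<sigma>) differentiable (at x)" if "j < 3" for j
      using dU[OF that] that by (auto simp: DU real_differentiable_def)
    have "deriv (p_GOE n \<sigma>) x = c\<^sup>2 * u 1 (c * x)"
      using DU[of 1] by (simp add: U_def power2_eq_square)
    moreover have "(deriv ^^ 3) (p_GOE n \<sigma>) x = c ^ 4 * u 3 (c * x)"
      using DU[of 3] by (simp add: U_def eval_nat_numeral)
    moreover have "deriv (p_GUE n \<sigma>) x = c\<^sup>2 * (- s * f (c * x) * g (c * x))"
      using dGUE by (rule DERIV_imp_deriv)
    ultimately show "4 * \<sigma> ^ 4 * (deriv ^^ 3) (p_GOE n \<sigma>) x
        + (\<sigma>\<^sup>2 * (4 * real n - 2) - x\<^sup>2) * deriv (p_GOE n \<sigma>) x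
        - 2 * x * p_GOE n \<sigma> x
      = - 3 * \<sigma>\<^sup>2 * deriv (p_GUE n \<sigma>) x - 3 * x * p_GUE n \<sigma> x"
      \<comment> \<open>By \<open>c2\<close>, \<open>4 \<sigma>^4 c^4 = 1\<close> and
        \<open>\<sigma>^2 c^2 = 1/2\<close>, so the claim becomes \<open>ode\<close> at
        \<open>c * x\<close>.\<close>
      using ode[of "c * x"] c2 s2 unfolding GUE GOE by algebra
  qed
qed

end
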